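(* For every integer $d\ge 1$ there exists a constant $c_d>0$, depending only on $d$, such that for every $\epsilon>0$ and every $\delta>0$ there exist distributions $P,Q\in\mathcal{P}_d$ with $\epsilon_P\ge\epsilon$, $\epsilon_Q\ge\epsilon$ and $d_{\mathrm W}(P,Q)\le\delta$ such that \[ d_{\mathrm H}\bigl(\psi^*(P),\psi^*(Q)\bigr)\ge c_d\cdot\min\bigl\{1,(\delta/\epsilon)^{1/4}\bigr\}. \]
   Context: $\mathcal{P}_d$ is the set of probability distributions $P$ on $\mathbb{R}^d$ with $\mathbb{E}_P[\|X\|]<\infty$ and $\mathbb{P}_P\{X\in H\}<1$ for every (affine) hyperplane $H\subseteq\mathbb{R}^d$; here $\|\cdot\|$ is the Euclidean norm and the subscript $P$ means $X\sim P$. $\mathcal{F}_d$ is the set of upper semi-continuous log-concave probability densities (with respect to Lebesgue measure) on $\mathbb{R}^d$. The log-concave projection $\psi^*:\mathcal{P}_d\to\mathcal{F}_d$ is $\psi^*(P)=\operatorname{argmax}_{f\in\mathcal{F}_d}\mathbb{E}_P[\log f(X)]$; it is known that for $P\in\mathcal{P}_d$ the maximizer exists and is unique. For $P$ with $\mathbb{E}_P[\|X\|]<\infty$, $\mu_P=\mathbb{E}_P[X]$ and $\epsilon_P=\inf_{u\in\mathbb{R}^d,\|u\|=1}\mathbb{E}_P\bigl[|u^\top(X-\mu_P)|\bigr]$. $d_{\mathrm W}(P,Q)=\inf\mathbb{E}[\|X-Y\|]$, the infimum over all couplings $(X,Y)$ with $X\sim P$, $Y\sim Q$ ($L_1$-Wasserstein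 distance). For densities $f,g$ on $\mathbb{R}^d$, the Hellinger distance $d_{\mathrm H}\ge 0$ is given by $d_{\mathrm H}^2(f,g)=\int_{\mathbb{R}^d}(\sqrt{f(x)}-\sqrt{g(x)})^2\,dx$. *)

theory Defs
  imports "HOL-Probability.Probability"
begin

definition projectable_distributions :: "'a::euclidean_space measure set" where
  "projectable_distributions = {P. prob_space P \<and> sets P = sets borel \<and>
     integrable P norm \<and> (\<forall>a b. a \<noteq> 0 \<longrightarrow> measure P {x. a \<bullet> x = b} < 1)}"

definition upper_semicontinuous :: "('a::topological_space \<Rightarrow> real) \<Rightarrow> bool" where
  "upper_semicontinuous f \<longleftrightarrow> (\<forall>x. \<forall>a>f x. \<forall>\<^sub>F y in at x. f y < a)"

(* Concavity of log f as a function into [-infinity, infinity): the effective domain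
   {x. 0 < f x} is convex (this is part of concave_on) and log f is concave on it. *)
definition log_concave_fun :: "('a::real_vector \<Rightarrow> real) \<Rightarrow> bool" where
  "log_concave_fun f \<longleftrightarrow> (\<forall>x. 0 \<le> f x) \<and> concave_on {x. 0 < f x} (\<lambda>x. ln (f x))"

definition log_concave_densities :: "('a::euclidean_space \<Rightarrow> real) set" where
  "log_concave_densities = {f. f \<in> borel_measurable borel \<and> upper_semicontinuous f \<and>
     log_concave_fun f \<and> (\<integral>\<^sup>+x. ennreal (f x) \<partial>lborel) = 1}"

definition ereal_ln :: "real \<Rightarrow> ereal" where
  "ereal_ln x = (if 0 < x then ereal (ln x) else -\<infinity>)"

(* e2ennreal truncates negative values to 0, so this is the expectation of log f as the
   difference of those of its positive and negative parts. Elements of log_concave_densities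
   are bounded, so for a probability measure P the first term is finite and the
   difference is well defined, with value -infinity allowed. *)
definition expected_log :: "'a measure \<Rightarrow> ('a \<Rightarrow> real) \<Rightarrow> ereal" where
  "expected_log P f =
     enn2ereal (\<integral>\<^sup>+x. e2ennreal (ereal_ln (f x)) \<partial>P) -
     enn2ereal (\<integral>\<^sup>+x. e2ennreal (- ereal_ln (f x)) \<partial>P)"

definition log_concave_projection :: "'a::euclidean_space measure \<Rightarrow> 'a \<Rightarrow> real" where
  "log_concave_projection P = arg_max_on (expected_log P) log_concave_densities"

definition mean :: "'a::euclidean_space measure \<Rightarrow> 'a" where
  "mean P = (\<integral>x. x \<partial>P)"

definition eps :: "'a::euclidean_space measure \<Rightarrow> real" where
  "eps P = (INF u\<in>{u. norm u = 1}. \<integral>x. \<bar>u \<bullet> (x - mean P)\<bar> \<partial>P)"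

definition couplings :: "'a::euclidean_space measure \<Rightarrow> 'a measure \<Rightarrow> ('a \<times> 'a) measure set" where
  "couplings P Q = {\<gamma>. prob_space \<gamma> \<and> sets \<gamma> = sets (borel \<Otimes>\<^sub>M borel) \<and>
     distr \<gamma> borel fst = P \<and> distr \<gamma> borel snd = Q}"

definition wasserstein :: "'a::euclidean_space measure \<Rightarrow> 'a measure \<Rightarrow> ennreal" where
  "wasserstein P Q = (INF \<gamma>\<in>couplings P Q. \<integral>\<^sup>+(x, y). ennreal (norm (x - y)) \<partial>\<gamma>)"

definition hellinger :: "('a::euclidean_space \<Rightarrow> real) \<Rightarrow> ('a \<Rightarrow> real) \<Rightarrow> real" where
  "hellinger f g = sqrt (\<integral>x. (sqrt (f x) - sqrt (g x))\<^sup>2 \<partial>lborel)"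

end

theory Submission
  imports Defs
begin

text \<open>Distributions with a log-concave density are their own projections, because
  \<open>E\<^sub>f[log g] \<le> E\<^sub>f[log f] - d\<^sub>H\<^sup>2(f, g)\<close>. It therefore suffices to compare two log-concave densities:
  the uniform one on a cube \<open>[-R, R]\<^sup>d\<close>, and the one obtained by replacing a face of the cube,
  in one coordinate direction, by a linear descent over the interval \<open>[R - h, R + h]\<close>. The
  second arises from the first by reflecting part of the mass through that face, so a mass of
  order \<open>h / R\<close> moves a distance of order \<open>h\<close>. This gives \<open>d\<^sub>W \<le> h\<^sup>2 / R\<close>, while \<open>d\<^sub>H\<^sup>2\<close> is at least
  the order \<open>h / R\<close> of the mass outside the cube. One takes \<open>R\<close> a multiple of \<open>\<epsilon>\<close> and
  \<open>h = min (R / 2) (sqrt (\<delta> R))\<close>.\<close>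

subsection \<open>Projections of log-concave densities\<close>

text \<open>At \<open>y = 0\<close> both sides are 0: minus infinity is truncated and
  \<open>ln 0\<close> is 0 by default. Zeros of a density thus show up only in the negative part of
  its expected log.\<close>

lemma e2ennreal_ereal_ln: "0 \<le> y \<Longrightarrow> e2ennreal (ereal_ln y) = ennreal (ln y)"
  by (auto simp: ereal_ln_def e2ennreal_neg)

lemma e2ennreal_uminus_ereal_ln:
  "e2ennreal (- ereal_ln y) = (if 0 < y then ennreal (- ln y) else \<top>)"
  by (auto simp: ereal_ln_def)

text \<open>The inequality \<open>ln t \<le> t - 1\<close> is applied to the square root of
  \<open>b / a\<close> instead of to \<open>b / a\<close>; doubling it produces the cross term of a
  squared Hellinger integrand.\<close>

lemma mult_ln_le_sqrt_mult:
  fixes a b :: real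
  assumes "0 \<le> a" "0 < b"
  shows "a * ln b \<le> a * ln a - a + 2 * sqrt a * sqrt b - a"
proof (cases "a = 0")
  case False
  with assms have a: "0 < a" by simp
  have "ln (sqrt (b / a)) \<le> sqrt (b / a) - 1"
    using a assms by (intro ln_le_minus_one) simp
  moreover have "ln (sqrt (b / a)) = (ln b - ln a) / 2"
    using a assms by (simp add: ln_sqrt ln_div)
  ultimately have "ln b \<le> ln a + 2 * (sqrt (b / a) - 1)" by simp
  then have "a * ln b \<le> a * (ln a + 2 * (sqrt (b / a) - 1))"
    using a by (intro mult_left_mono) auto
  also have "a * sqrt (b / a) = sqrt a * sqrt b"
    using a by (metis real_sqrt_divide real_div_sqrt times_divide_eq_right
        less_imp_le times_divide_eq_left)
  then have "a * (ln a + 2 * (sqrt (b / a) - 1)) = a * ln a - a + 2 * sqrt a * sqrt b - a"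
    by (simp add: algebra_simps)
  finally show ?thesis .
qed simp

text \<open>Pointwise form of Gibbs' inequality with remainder. After integration against two
  probability densities the terms \<open>b - a\<close> cancel.\<close>

lemma mult_ln_le_hellinger:
  fixes a b :: real
  assumes "0 \<le> a" "0 \<le> b" "b = 0 \<Longrightarrow> a = 0"
  shows "a * ln b \<le> a * ln a - (sqrt a - sqrt b)\<^sup>2 + b - a"
proof (cases "b = 0")
  case False
  then show ?thesis
    using mult_ln_le_sqrt_mult[of a b] assms by (simp add: power2_diff algebra_simps)
qed (use assms in simp)

lemma integrable_hellinger:
  fixes f g :: "'a \<Rightarrow> real"
  assumes "integrable M f" "integrable M g" "\<And>x. 0 \<le> f x" "\<And>x. 0 \<le> g x"
  shows "integrable M (\<lambda>x. (sqrt (f x) - sqrt (g x))\<^sup>2)"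
proof (rule Bochner_Integration.integrable_bound)
  show "integrable M (\<lambda>x. f x + g x)" using assms by simp
  have [measurable]: "f \<in> borel_measurable M" "g \<in> borel_measurable M" using assms by auto
  show "(\<lambda>x. (sqrt (f x) - sqrt (g x))\<^sup>2) \<in> borel_measurable M" by measurable
  show "AE x in M. norm ((sqrt (f x) - sqrt (g x))\<^sup>2) \<le> norm (f x + g x)"
  proof (rule AE_I2)
    fix x
    have "(sqrt (f x) - sqrt (g x))\<^sup>2 = f x + g x - 2 * (sqrt (f x) * sqrt (g x))"
      using assms(3,4) by (simp add: power2_diff)
    moreover have "0 \<le> sqrt (f x) * sqrt (g x)" using assms(3,4) by simp
    ultimately show "norm ((sqrt (f x) - sqrt (g x))\<^sup>2) \<le> norm (f x + g x)"
      using zero_le_power2[of "sqrt (f x) - sqrt (g x)"] unfolding real_norm_def by linarith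
  qed
qed

text \<open>Where a density vanishes, \<open>ereal_ln\<close> is minus infinity while \<open>ln\<close> is the junk value 0,
  hence the almost-everywhere clause.\<close>
lemma expected_log_cases:
  fixes f g :: "'a::euclidean_space \<Rightarrow> real"
  assumes f: "integrable lborel f" "\<And>x. 0 \<le> f x"
    and g: "integrable lborel g" "\<And>x. 0 \<le> g x"
    and ent: "integrable lborel (\<lambda>x. f x * ln (f x))"
  obtains "expected_log (density lborel f) g = -\<infinity>"
  | "AE x in lborel. g x = 0 \<longrightarrow> f x = 0" "integrable lborel (\<lambda>x. f x * ln (g x))"
    "expected_log (density lborel f) g = ereal (\<integral>x. f x * ln (g x) \<partial>lborel)"
proof -
  have [measurable]: "f \<in> borel_measurable borel" "g \<in> borel_measurable borel" using f g by auto
  have [measurable]: "(\<lambda>x. e2ennreal (- ereal_ln (g x))) \<in> borel_measurable borel"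
    unfolding e2ennreal_uminus_ereal_ln by measurable
  define p where "p = (\<integral>\<^sup>+x. ennreal (f x * ln (g x)) \<partial>lborel)"
  define n where "n = (\<integral>\<^sup>+x. ennreal (f x) * e2ennreal (- ereal_ln (g x)) \<partial>lborel)"
  have el: "expected_log (density lborel f) g = enn2ereal p - enn2ereal n"
    unfolding expected_log_def p_def n_def
    by (simp add: nn_integral_density e2ennreal_ereal_ln g f ennreal_mult')
  \<comment> \<open>The pointwise Gibbs bound makes the positive part finite. Where \<open>g\<close>
    vanishes, the default \<open>ln 0 = 0\<close> makes the integrand 0. So only the negative part
    \<open>n\<close> can be infinite.\<close>
  have "p \<le> (\<integral>\<^sup>+x. ennreal (\<bar>f x * ln (f x)\<bar> + g x) \<partial>lborel)"
    unfolding p_def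
  proof (intro nn_integral_mono ennreal_leI)
    fix x
    show "f x * ln (g x) \<le> \<bar>f x * ln (f x)\<bar> + g x"
    proof (cases "g x = 0")
      case False
      then have "f x * ln (g x) \<le> f x * ln (f x) - (sqrt (f x) - sqrt (g x))\<^sup>2 + g x - f x"
        using f g by (intro mult_ln_le_hellinger) auto
      then show ?thesis using f(2)[of x] zero_le_power2[of "sqrt (f x) - sqrt (g x)"]
        by linarith
    qed auto
  qed
  also have "\<dots> < \<infinity>"
    using ent g by (subst nn_integral_eq_integral) auto
  finally have p: "p < \<infinity>" .
  show ?thesis
  proof (cases "n = \<infinity>")
    case True
    with p have "expected_log (density lborel f) g = -\<infinity>"
      unfolding el by (cases p) (auto simp: less_top[symmetric])
    then show ?thesis by (rule that(1))
  next
    case False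
    \<comment> \<open>The integrand of \<open>n\<close> is infinite exactly where \<open>g\<close>
      vanishes and \<open>f\<close> does not, since 0 times infinity is 0 in
      \<open>ennreal\<close>.\<close>
    then have "AE x in lborel. ennreal (f x) * e2ennreal (- ereal_ln (g x)) \<noteq> \<infinity>"
      unfolding n_def by (intro nn_integral_noteq_infinite) auto
    then have ae: "AE x in lborel. g x = 0 \<longrightarrow> f x = 0"
    proof eventually_elim
      case (elim x)
      then show ?case
        using f(2)[of x] by (auto simp: e2ennreal_uminus_ereal_ln ennreal_mult_eq_top_iff)
    qed
    have n_eq: "n = (\<integral>\<^sup>+x. ennreal (- (f x * ln (g x))) \<partial>lborel)"
      unfolding n_def
    proof (intro nn_integral_cong_AE, use ae in eventually_elim)
      case (elim x)
      then show ?case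
        using f(2)[of x] g(2)[of x]
        by (auto simp: e2ennreal_uminus_ereal_ln less_le ennreal_mult'[symmetric])
    qed
    have int: "integrable lborel (\<lambda>x. f x * ln (g x))"
      unfolding real_integrable_def using p False by (auto simp: p_def[symmetric] n_eq[symmetric])
    have "expected_log (density lborel f) g = ereal (enn2real p - enn2real n)"
      unfolding el using p False by (cases p; cases n) (auto simp: less_top[symmetric])
    also have "enn2real p - enn2real n = (\<integral>x. f x * ln (g x) \<partial>lborel)"
      unfolding real_lebesgue_integral_def[OF int] p_def n_eq ..
    finally show ?thesis by (rule that(2)[OF ae int])
  qed
qed

text \<open>Gibbs' inequality, with the squared Hellinger distance as a remainder: the latter
  forces every maximizer to agree with \<open>f\<close> almost everywhere.\<close>
lemma gibbs_hellinger:
  fixes f g :: "'a::euclidean_space \<Rightarrow> real"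
  assumes f: "integrable lborel f" "\<And>x. 0 \<le> f x" "integral\<^sup>L lborel f = 1"
    and g: "integrable lborel g" "\<And>x. 0 \<le> g x" "integral\<^sup>L lborel g = 1"
    and ent: "integrable lborel (\<lambda>x. f x * ln (f x))"
  shows "expected_log (density lborel f) g
    \<le> expected_log (density lborel f) f - ereal (\<integral>x. (sqrt (f x) - sqrt (g x))\<^sup>2 \<partial>lborel)"
    and "expected_log (density lborel f) f = ereal (\<integral>x. f x * ln (f x) \<partial>lborel)"
proof -
  have [measurable]: "f \<in> borel_measurable borel" using f by auto
  show el: "expected_log (density lborel f) f = ereal (\<integral>x. f x * ln (f x) \<partial>lborel)"
  proof -
    have "enn2ereal (\<integral>\<^sup>+x. e2ennreal (ereal_ln (f x)) \<partial>density lborel f) =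
        enn2ereal (\<integral>\<^sup>+x. ennreal (f x * ln (f x)) \<partial>lborel)"
      by (simp add: nn_integral_density e2ennreal_ereal_ln f ennreal_mult')
    \<comment> \<open>Points with \<open>f x = 0\<close> contribute 0 to both sides: 0 times
      infinity on the left, \<open>0 * ln 0\<close> on the right.\<close>
    moreover have "(\<integral>\<^sup>+x. e2ennreal (- ereal_ln (f x)) \<partial>density lborel f) =
        (\<integral>\<^sup>+x. ennreal (- (f x * ln (f x))) \<partial>lborel)"
      unfolding e2ennreal_uminus_ereal_ln
      using f(2) by (subst nn_integral_density)
        (auto intro!: nn_integral_cong simp: less_le ennreal_mult'[symmetric])
    moreover have "(\<integral>\<^sup>+x. ennreal (f x * ln (f x)) \<partial>lborel) \<noteq> \<infinity>"
      "(\<integral>\<^sup>+x. ennreal (- (f x * ln (f x))) \<partial>lborel) \<noteq> \<infinity>"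
      using ent unfolding real_integrable_def by auto
    ultimately show ?thesis
      unfolding expected_log_def real_lebesgue_integral_def[OF ent]
      by (cases "\<integral>\<^sup>+x. ennreal (f x * ln (f x)) \<partial>lborel";
          cases "\<integral>\<^sup>+x. ennreal (- (f x * ln (f x))) \<partial>lborel") auto
  qed
  have H: "integrable lborel (\<lambda>x. (sqrt (f x) - sqrt (g x))\<^sup>2)"
    using f g by (intro integrable_hellinger)
  show "expected_log (density lborel f) g
    \<le> expected_log (density lborel f) f - ereal (\<integral>x. (sqrt (f x) - sqrt (g x))\<^sup>2 \<partial>lborel)"
  proof (rule expected_log_cases[OF f(1,2) g(1,2) ent])
    assume ae: "AE x in lborel. g x = 0 \<longrightarrow> f x = 0"
      and int: "integrable lborel (\<lambda>x. f x * ln (g x))"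
      and eq: "expected_log (density lborel f) g = ereal (\<integral>x. f x * ln (g x) \<partial>lborel)"
    have "(\<integral>x. f x * ln (g x) \<partial>lborel)
        \<le> (\<integral>x. f x * ln (f x) - (sqrt (f x) - sqrt (g x))\<^sup>2 + g x - f x \<partial>lborel)"
    proof (rule integral_mono_AE)
      show "AE x in lborel. f x * ln (g x)
          \<le> f x * ln (f x) - (sqrt (f x) - sqrt (g x))\<^sup>2 + g x - f x"
        using ae by eventually_elim (use f g mult_ln_le_hellinger in auto)
    qed (use int ent H f g in auto)
    also have "\<dots> = (\<integral>x. f x * ln (f x) \<partial>lborel) - (\<integral>x. (sqrt (f x) - sqrt (g x))\<^sup>2 \<partial>lborel)"
      using ent H f g by simp
    finally show ?thesis unfolding eq el by simp
  qed simp
qed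

text \<open>By Gibbs' inequality \<open>f\<close> is a maximizer, and any other maximizer has zero
  Hellinger distance to it. Equality almost everywhere suffices, as Hellinger integrals ignore null
  sets.\<close>

lemma log_concave_projection_AE_eq:
  fixes f :: "'a::euclidean_space \<Rightarrow> real"
  assumes f: "f \<in> log_concave_densities"
    and ent: "integrable lborel (\<lambda>x. f x * ln (f x))"
  shows "AE x in lborel. log_concave_projection (density lborel f) x = f x"
    and "log_concave_projection (density lborel f) \<in> borel_measurable borel"
proof -
  let ?E = "expected_log (density lborel f)"
  have dens: "integrable lborel g" "\<And>x. 0 \<le> g x" "integral\<^sup>L lborel g = 1"
    if "g \<in> log_concave_densities" for g :: "'a \<Rightarrow> real"
  proof -
    from that have [measurable]: "g \<in> borel_measurable borel"
      and nn: "\<And>x. 0 \<le> g x" and 1: "(\<integral>\<^sup>+x. ennreal (g x) \<partial>lborel) = 1"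
      by (auto simp: log_concave_densities_def log_concave_fun_def)
    show "integrable lborel g" using nn 1 by (intro integrableI_nonneg) auto
    show "\<And>x. 0 \<le> g x" by (fact nn)
    show "integral\<^sup>L lborel g = 1" using nn 1 by (simp add: integral_eq_nn_integral)
  qed
  have gibbs: "?E g \<le> ?E f - ereal (\<integral>x. (sqrt (f x) - sqrt (g x))\<^sup>2 \<partial>lborel)"
    and fin: "?E f = ereal (\<integral>x. f x * ln (f x) \<partial>lborel)"
    if "g \<in> log_concave_densities" for g
    using gibbs_hellinger[OF dens[OF f] dens[OF that] ent] by auto
  have le: "\<not> ?E f < ?E g" if "g \<in> log_concave_densities" for g
  proof -
    have "?E f - ereal (\<integral>x. (sqrt (f x) - sqrt (g x))\<^sup>2 \<partial>lborel) \<le> ?E f"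
      unfolding fin[OF that] by simp
    with gibbs[OF that] show ?thesis by (meson leD order_trans)
  qed
  define g where "g = log_concave_projection (density lborel f)"
  \<comment> \<open>\<open>arg_max_on\<close> is a Hilbert choice, so its defining property is
    available only once a maximizer is exhibited; \<open>f\<close> is one.\<close>
  have "is_arg_max ?E (\<lambda>g. g \<in> log_concave_densities) g"
    unfolding g_def log_concave_projection_def arg_max_on_def arg_max_def
    by (rule someI[of _ f]) (use f le in \<open>auto simp: is_arg_max_def\<close>)
  then have g: "g \<in> log_concave_densities" and max: "?E f \<le> ?E g"
    using f by (auto simp: is_arg_max_def not_less)
  have H: "integrable lborel (\<lambda>x. (sqrt (f x) - sqrt (g x))\<^sup>2)"
    by (intro integrable_hellinger dens f g)
  \<comment> \<open>\<open>?E f\<close> is a finite real by the entropy assumption, so it cancels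
    from \<open>?E f \<le> ?E f\<close> minus the remainder.\<close>
  have "(\<integral>x. (sqrt (f x) - sqrt (g x))\<^sup>2 \<partial>lborel) \<le> 0"
    using order_trans[OF max gibbs[OF g]] unfolding fin[OF g] by simp
  then have "(\<integral>x. (sqrt (f x) - sqrt (g x))\<^sup>2 \<partial>lborel) = 0" by (simp add: order_antisym)
  then have "AE x in lborel. (sqrt (f x) - sqrt (g x))\<^sup>2 = 0"
    by (subst (asm) integral_nonneg_eq_0_iff_AE[OF H]) auto
  then show "AE x in lborel. log_concave_projection (density lborel f) x = f x"
    unfolding g_def[symmetric] by eventually_elim simp
  show "log_concave_projection (density lborel f) \<in> borel_measurable borel"
    unfolding g_def[symmetric] using g by (simp add: log_concave_densities_def)
qed

lemma hellinger_cong_AE: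
  assumes "AE x in lborel. f x = f' x" "AE x in lborel. g x = g' x"
    and [measurable]: "f \<in> borel_measurable borel" "f' \<in> borel_measurable borel"
    "g \<in> borel_measurable borel" "g' \<in> borel_measurable borel"
  shows "hellinger f g = hellinger f' g'"
proof -
  have "AE x in lborel. (sqrt (f x) - sqrt (g x))\<^sup>2 = (sqrt (f' x) - sqrt (g' x))\<^sup>2"
    using assms(1,2) by eventually_elim simp
  then show ?thesis
    unfolding hellinger_def by (intro arg_cong[where f = sqrt] integral_cong_AE) auto
qed

section \<open>Criteria for log-concave densities, finite entropy and projectable
  distributions\<close>

lemma hyperplane_null_sets_lborel:
  fixes a :: "'a::euclidean_space"
  assumes "a \<noteq> 0"
  shows "{x. a \<bullet> x = b} \<in> null_sets lborel"
proof -
  have "{x. a \<bullet> x = b} \<in> sets lborel" using closed_hyperplane by simp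
  moreover have "{x. a \<bullet> x = b} \<in> null_sets lebesgue"
    using negligible_hyperplane assms negligible_iff_null_sets by blast
  ultimately show ?thesis by (simp add: null_sets_completion_iff)
qed

text \<open>\<open>ln\<close> is concave and increasing. The restricted set stays convex because a
  convex combination of two positive values is positive and bounds \<open>\<phi>\<close> from
  below.\<close>

lemma concave_on_ln_comp:
  fixes \<phi> :: "'a::real_vector \<Rightarrow> real"
  assumes "concave_on S \<phi>"
  shows "concave_on {x \<in> S. 0 < \<phi> x} (\<lambda>x. ln (\<phi> x))"
  unfolding concave_on_iff
proof (intro conjI ballI allI impI)
  let ?T = "{x \<in> S. 0 < \<phi> x}"
  have *: "u *\<^sub>R x + v *\<^sub>R y \<in> ?T \<and> u * \<phi> x + v * \<phi> y \<le> \<phi> (u *\<^sub>R x + v *\<^sub>R y)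
      \<and> 0 < u * \<phi> x + v * \<phi> y"
    if xy: "x \<in> ?T" "y \<in> ?T" and uv: "0 \<le> u" "0 \<le> v" "u + v = 1" for x y u v
  proof -
    have "u *\<^sub>R x + v *\<^sub>R y \<in> S"
      using concave_on_imp_convex[OF assms] xy uv unfolding convex_def by blast
    moreover have 1: "u * \<phi> x + v * \<phi> y \<le> \<phi> (u *\<^sub>R x + v *\<^sub>R y)"
      using assms xy uv unfolding concave_on_iff by blast
    moreover have 2: "0 < u * \<phi> x + v * \<phi> y"
    proof (cases "u = 0")
      case False
      with uv xy show ?thesis by (intro add_pos_nonneg mult_pos_pos mult_nonneg_nonneg) auto
    qed (use uv xy in auto)
    ultimately show ?thesis by auto
  qed
  show "convex ?T" unfolding convex_def using * by blast
  fix x y u v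
  assume xy: "x \<in> ?T" "y \<in> ?T" and uv: "(0::real) \<le> u" "(0::real) \<le> v" "u + v = 1"
  have "concave_on {0<..} (ln :: real \<Rightarrow> real)" by (rule ln_concave)
  then have "u * ln (\<phi> x) + v * ln (\<phi> y) \<le> ln (u *\<^sub>R \<phi> x + v *\<^sub>R \<phi> y)"
    using xy uv unfolding concave_on_iff by auto
  also have "\<dots> \<le> ln (\<phi> (u *\<^sub>R x + v *\<^sub>R y))"
    using *[OF xy uv] by auto
  finally show "u * ln (\<phi> x) + v * ln (\<phi> y) \<le> ln (\<phi> (u *\<^sub>R x + v *\<^sub>R y))" .
qed

text \<open>At a point of the closed set \<open>S\<close> the cut to 0 can only lower nearby values,
  as \<open>\<phi>\<close> is nonnegative there; outside \<open>S\<close> the function is locally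
  0.\<close>

lemma upper_semicontinuous_truncate:
  fixes \<phi> :: "'a::topological_space \<Rightarrow> real"
  assumes "closed S" "continuous_on UNIV \<phi>" "\<And>x. x \<in> S \<Longrightarrow> 0 \<le> \<phi> x"
  shows "upper_semicontinuous (\<lambda>x. if x \<in> S then \<phi> x else 0)"
  unfolding upper_semicontinuous_def
proof (intro allI impI)
  fix x a assume a: "(if x \<in> S then \<phi> x else 0) < a"
  show "\<forall>\<^sub>F y in at x. (if y \<in> S then \<phi> y else 0) < a"
  proof (cases "x \<in> S")
    case True
    with a assms(3)[OF True] have "\<phi> x < a" "0 < a" by auto
    moreover have "(\<phi> \<longlongrightarrow> \<phi> x) (at x)"
      using assms(2) by (simp add: continuous_on_def)
    ultimately have "\<forall>\<^sub>F y in at x. \<phi> y < a" by (simp add: order_tendstoD(2))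
    then show ?thesis by eventually_elim (use \<open>0 < a\<close> in auto)
  next
    case False
    with assms(1) have "\<forall>\<^sub>F y in at x. y \<in> - S"
      by (auto simp: eventually_at_topological)
    then show ?thesis by eventually_elim (use a False in auto)
  qed
qed

lemma log_concave_densities_truncate:
  fixes \<phi> :: "'a::euclidean_space \<Rightarrow> real"
  assumes S: "closed S" and \<phi>: "continuous_on UNIV \<phi>" "concave_on S \<phi>"
    and nn: "\<And>x. x \<in> S \<Longrightarrow> 0 \<le> \<phi> x"
    and 1: "(\<integral>\<^sup>+x. ennreal (if x \<in> S then \<phi> x else 0) \<partial>lborel) = 1"
  shows "(\<lambda>x. if x \<in> S then \<phi> x else 0) \<in> log_concave_densities"
proof -
  let ?F = "\<lambda>x. if x \<in> S then \<phi> x else 0"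
  have [measurable]: "S \<in> sets borel" "\<phi> \<in> borel_measurable borel"
    using S \<phi> by (auto intro: borel_measurable_continuous_onI)
  have pos: "{x. 0 < ?F x} = {x \<in> S. 0 < \<phi> x}" by auto
  have "concave_on {x. 0 < ?F x} (\<lambda>x. ln (?F x))"
    unfolding pos using concave_on_ln_comp[OF \<phi>(2)] by (auto simp: concave_on_iff convex_def)
  then show ?thesis
    using nn 1 upper_semicontinuous_truncate[OF S \<phi>(1) nn]
    by (auto simp: log_concave_densities_def log_concave_fun_def)
qed

text \<open>Apply \<open>ln t \<le> t - 1\<close> to \<open>x\<close> for the upper bound and to
  \<open>1 / x\<close> for the lower one. Unlike the logarithm, the resulting bound is continuous in
  \<open>x\<close> and so integrable over compact supports.\<close>

lemma abs_mult_ln_le: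
  fixes x :: real
  assumes "0 \<le> x"
  shows "\<bar>x * ln x\<bar> \<le> 1 + x * x"
proof (cases "x = 0")
  case False
  then have x: "0 < x" using assms by simp
  have "x * ln x \<le> x * (x - 1)" using x ln_le_minus_one by (intro mult_left_mono) auto
  moreover have "x * - ln x \<le> x * (1 / x - 1)"
    using x ln_le_minus_one[of "1 / x"] by (intro mult_left_mono) (auto simp: ln_div)
  ultimately show ?thesis using x by (simp add: algebra_simps abs_le_iff add_increasing2)
qed simp

lemma integrable_entropy_truncate:
  fixes \<phi> :: "'a::euclidean_space \<Rightarrow> real"
  assumes S: "compact S" and \<phi>: "continuous_on UNIV \<phi>" and nn: "\<And>x. x \<in> S \<Longrightarrow> 0 \<le> \<phi> x"
  defines "F \<equiv> \<lambda>x. if x \<in> S then \<phi> x else 0"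
  shows "integrable lborel (\<lambda>x. F x * ln (F x))"
proof (rule Bochner_Integration.integrable_bound)
  have [measurable]: "S \<in> sets borel" "\<phi> \<in> borel_measurable borel"
    using compact_imp_closed[OF S] \<phi> by (auto intro: borel_measurable_continuous_onI)
  show "integrable lborel (\<lambda>x. indicator S x *\<^sub>R (1 + \<phi> x * \<phi> x))"
    using S \<phi> by (intro borel_integrable_compact continuous_intros)
      (auto intro: continuous_on_subset)
  show "(\<lambda>x. F x * ln (F x)) \<in> borel_measurable lborel" unfolding F_def by measurable
  show "AE x in lborel. norm (F x * ln (F x)) \<le> norm (indicator S x *\<^sub>R (1 + \<phi> x * \<phi> x))"
  proof (rule AE_I2)
    fix x
    have "0 \<le> 1 + \<phi> x * \<phi> x" by (simp add: add_increasing)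
    then show "norm (F x * ln (F x)) \<le> norm (indicator S x *\<^sub>R (1 + \<phi> x * \<phi> x))"
      using abs_mult_ln_le[of "\<phi> x"] nn by (auto simp: F_def abs_of_nonneg)
  qed
qed

text \<open>Bounded support gives the first moment, and absolute continuity gives every hyperplane
  mass 0.\<close>

lemma projectable_density_compact:
  fixes f :: "'a::euclidean_space \<Rightarrow> real"
  assumes [measurable]: "f \<in> borel_measurable borel" and nn: "\<And>x. 0 \<le> f x"
    and 1: "(\<integral>\<^sup>+x. ennreal (f x) \<partial>lborel) = 1"
    and S: "bounded S" "\<And>x. x \<notin> S \<Longrightarrow> f x = 0"
  shows "density lborel f \<in> projectable_distributions"
proof -
  let ?P = "density lborel f"
  interpret P: prob_space ?P by (rule prob_spaceI) (simp add: emeasure_density 1)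
  obtain C where C: "\<And>x. x \<in> S \<Longrightarrow> norm x \<le> C" using S(1) bounded_iff by blast
  have "AE x in ?P. norm (norm x) \<le> C"
    by (subst AE_density) (simp, intro AE_I2 impI, metis C S(2) ennreal_0 less_irrefl real_norm_def abs_norm_cancel)
  then have "integrable ?P norm" by (intro P.integrable_const_bound) auto
  moreover have "measure ?P {x. a \<bullet> x = b} < 1" if "a \<noteq> 0" for a b
  proof -
    have "absolutely_continuous lborel ?P" by (rule absolutely_continuousI_density) simp
    then have "{x. a \<bullet> x = b} \<in> null_sets ?P"
      using hyperplane_null_sets_lborel[OF that] by (auto simp: absolutely_continuous_def)
    then show ?thesis by (simp add: measure_def null_sets_def)
  qed
  ultimately show ?thesis
    by (auto simp: projectable_distributions_def P.prob_space_axioms)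
qed

subsection \<open>Couplings by reflection\<close>

text \<open>The common mass \<open>w\<^sub>1\<close> stays in place and the excess \<open>w\<^sub>2\<close> is moved by \<open>\<sigma>\<close>. The coupling
  is the law of \<open>(x, if b then x else \<sigma> x)\<close>, where \<open>(x, b)\<close> has density \<open>w\<^sub>1\<close> on \<open>b\<close> and
  \<open>w\<^sub>2\<close> on \<open>\<not> b\<close>.\<close>
lemma wasserstein_le_involution:
  fixes w1 w2 :: "'a::euclidean_space \<Rightarrow> ennreal" and \<sigma> :: "'a \<Rightarrow> 'a"
  assumes [measurable]: "w1 \<in> borel_measurable borel" "w2 \<in> borel_measurable borel"
    "\<sigma> \<in> borel_measurable borel"
    and \<sigma>: "distr lborel borel \<sigma> = lborel" "\<And>x. \<sigma> (\<sigma> x) = x"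
    and 1: "(\<integral>\<^sup>+x. w1 x + w2 x \<partial>lborel) = 1"
  shows "wasserstein (density lborel (\<lambda>x. w1 x + w2 x)) (density lborel (\<lambda>x. w1 x + w2 (\<sigma> x)))
    \<le> (\<integral>\<^sup>+x. w2 x * ennreal (norm (x - \<sigma> x)) \<partial>lborel)"
proof -
  define w where "w = (\<lambda>(x, b). if b then w1 x else w2 x)"
  define T where "T = (\<lambda>(x, b). (x, if b then x else \<sigma> x))"
  let ?N = "lborel \<Otimes>\<^sub>M count_space (UNIV :: bool set)"
  define \<gamma> where "\<gamma> = distr (density ?N w) (borel \<Otimes>\<^sub>M borel) T"
  interpret C: sigma_finite_measure "count_space (UNIV :: bool set)"
    by (rule sigma_finite_measure_count_space_finite) simp
  have [measurable]: "w \<in> borel_measurable ?N"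
    unfolding w_def by measurable
  have [measurable]: "T \<in> measurable ?N (borel \<Otimes>\<^sub>M borel)"
    unfolding T_def by measurable
  \<comment> \<open>Summing over the two values of \<open>b\<close> turns every integral over the
    coupling into one over \<open>lborel\<close>; total mass, both marginals and the cost are
    instances.\<close>
  have int: "(\<integral>\<^sup>+z. h z \<partial>\<gamma>) = (\<integral>\<^sup>+x. w1 x * h (x, x) + w2 x * h (x, \<sigma> x) \<partial>lborel)"
    if [measurable]: "h \<in> borel_measurable (borel \<Otimes>\<^sub>M borel)" for h
  proof -
    have "(\<integral>\<^sup>+z. h z \<partial>\<gamma>) = (\<integral>\<^sup>+y. w y * h (T y) \<partial>?N)"
      unfolding \<gamma>_def by (simp add: nn_integral_distr nn_integral_density)
    also have "\<dots> = (\<integral>\<^sup>+x. \<integral>\<^sup>+b. w (x, b) * h (T (x, b)) \<partial>count_space UNIV \<partial>lborel)"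
      by (rule C.nn_integral_fst[symmetric]) measurable
    finally show ?thesis
      by (simp add: nn_integral_count_space_finite UNIV_bool w_def T_def add.commute)
  qed
  have \<sigma>_int: "(\<integral>\<^sup>+x. h (\<sigma> x) \<partial>lborel) = (\<integral>\<^sup>+x. h x \<partial>lborel)"
    if [measurable]: "h \<in> borel_measurable borel" for h
    by (subst (2) \<sigma>(1)[symmetric]) (simp add: nn_integral_distr)
  have sets_\<gamma> [simp, measurable_cong]: "sets \<gamma> = sets (borel \<Otimes>\<^sub>M borel)" by (simp add: \<gamma>_def)
  have "prob_space \<gamma>"
  proof (rule prob_spaceI)
    have "emeasure \<gamma> (space \<gamma>) = (\<integral>\<^sup>+z. 1 \<partial>\<gamma>)" by simp
    also have "\<dots> = 1" using 1 by (subst int) auto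
    finally show "emeasure \<gamma> (space \<gamma>) = 1" .
  qed
  moreover have "distr \<gamma> borel fst = density lborel (\<lambda>x. w1 x + w2 x)"
  proof (rule measure_eqI)
    fix A assume "A \<in> sets (distr \<gamma> borel fst)"
    then have [measurable]: "A \<in> sets borel" by simp
    have "emeasure (distr \<gamma> borel fst) A = (\<integral>\<^sup>+z. indicator A z \<partial>distr \<gamma> borel fst)" by simp
    also have "\<dots> = (\<integral>\<^sup>+z. indicator A (fst z) \<partial>\<gamma>)"
      by (subst nn_integral_distr) (auto)
    also have "\<dots> = (\<integral>\<^sup>+x. w1 x * indicator A x + w2 x * indicator A x \<partial>lborel)"
      by (subst int) auto
    finally show "emeasure (distr \<gamma> borel fst) A = emeasure (density lborel (\<lambda>x. w1 x + w2 x)) A"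
      by (simp add: emeasure_density distrib_right)
  qed simp
  moreover have "distr \<gamma> borel snd = density lborel (\<lambda>x. w1 x + w2 (\<sigma> x))"
  proof (rule measure_eqI)
    fix A assume "A \<in> sets (distr \<gamma> borel snd)"
    then have [measurable]: "A \<in> sets borel" by simp
    have "emeasure (distr \<gamma> borel snd) A = (\<integral>\<^sup>+z. indicator A z \<partial>distr \<gamma> borel snd)" by simp
    also have "\<dots> = (\<integral>\<^sup>+z. indicator A (snd z) \<partial>\<gamma>)"
      by (subst nn_integral_distr) (auto)
    also have "\<dots> = (\<integral>\<^sup>+x. w1 x * indicator A x \<partial>lborel) + (\<integral>\<^sup>+x. w2 x * indicator A (\<sigma> x) \<partial>lborel)"
      by (subst int) (auto intro: nn_integral_add)
    \<comment> \<open>Invariance of \<open>lborel\<close> under \<sigma>, together with \<sigma>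
      being an involution, shifts \<sigma> from the indicator to the weight.\<close>
    also have "(\<integral>\<^sup>+x. w2 x * indicator A (\<sigma> x) \<partial>lborel) = (\<integral>\<^sup>+x. w2 (\<sigma> x) * indicator A x \<partial>lborel)"
      using \<sigma>_int[of "\<lambda>x. w2 (\<sigma> x) * indicator A x"] \<sigma>(2) by simp
    finally show "emeasure (distr \<gamma> borel snd) A = emeasure (density lborel (\<lambda>x. w1 x + w2 (\<sigma> x))) A"
      by (simp add: emeasure_density distrib_right nn_integral_add)
  qed simp
  ultimately have "\<gamma> \<in> couplings (density lborel (\<lambda>x. w1 x + w2 x)) (density lborel (\<lambda>x. w1 x + w2 (\<sigma> x)))"
    by (simp add: couplings_def)
  then have "wasserstein (density lborel (\<lambda>x. w1 x + w2 x)) (density lborel (\<lambda>x. w1 x + w2 (\<sigma> x)))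
      \<le> (\<integral>\<^sup>+(x, y). ennreal (norm (x - y)) \<partial>\<gamma>)"
    unfolding wasserstein_def by (rule INF_lower)
  \<comment> \<open>The mass \<open>w1\<close> lies on the diagonal and costs nothing.\<close>
  also have "\<dots> = (\<integral>\<^sup>+x. w2 x * ennreal (norm (x - \<sigma> x)) \<partial>lborel)"
    by (subst int) auto
  finally show ?thesis .
qed

text \<open>The reflection in the hyperplane \<open>x \<bullet> b = R\<close> is a translation after
  a diagonal map with entries 1 and -1, hence has Jacobian 1.\<close>

lemma distr_lborel_reflection:
  fixes b :: "'a::euclidean_space" and R :: real
  assumes b: "b \<in> Basis"
  defines "\<sigma> \<equiv> \<lambda>x. x + (2 * (R - x \<bullet> b)) *\<^sub>R b"
  shows "distr lborel borel \<sigma> = lborel"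
proof -
  define c where "c = (\<lambda>j. if j = b then -1 else (1::real))"
  have eq: "(2 * R) *\<^sub>R b + (\<Sum>j\<in>Basis. (c j * (x \<bullet> j)) *\<^sub>R j) = \<sigma> x" for x
  proof (rule euclidean_eqI)
    fix i :: 'a assume "i \<in> Basis"
    then show "((2 * R) *\<^sub>R b + (\<Sum>j\<in>Basis. (c j * (x \<bullet> j)) *\<^sub>R j)) \<bullet> i = \<sigma> x \<bullet> i"
      using b by (auto simp: c_def \<sigma>_def inner_add_left inner_sum_left_Basis inner_Basis)
  qed
  have "lborel = density (distr lborel borel (\<lambda>x. (2 * R) *\<^sub>R b + (\<Sum>j\<in>Basis. (c j * (x \<bullet> j)) *\<^sub>R j)))
      (\<lambda>_. (\<Prod>j\<in>Basis. \<bar>c j\<bar>))"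
    by (rule lborel_affine_euclidean) (simp add: c_def)
  also have "(\<Prod>j\<in>(Basis :: 'a set). \<bar>c j\<bar>) = 1" by (intro prod.neutral) (simp add: c_def)
  finally show ?thesis unfolding eq by (simp add: density_1)
qed

subsection \<open>Boxes and the dispersion functional\<close>

text \<open>The bounds are functions of the basis vector, so that a function update changes the
  range in a single direction.\<close>

definition brick :: "('a::euclidean_space \<Rightarrow> real) \<Rightarrow> ('a \<Rightarrow> real) \<Rightarrow> 'a set" where
  "brick l u = cbox (\<Sum>j\<in>Basis. l j *\<^sub>R j) (\<Sum>j\<in>Basis. u j *\<^sub>R j)"

lemma mem_brick: "x \<in> brick l u \<longleftrightarrow> (\<forall>j\<in>Basis. l j \<le> x \<bullet> j \<and> x \<bullet> j \<le> u j)"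
  by (simp add: brick_def mem_box inner_sum_left_Basis)

lemma compact_brick: "compact (brick l u)"
  and convex_brick: "convex (brick l u)"
  by (simp_all add: brick_def)

lemma sets_brick [measurable]: "brick l u \<in> sets borel"
  by (simp add: brick_def)

lemma emeasure_brick:
  assumes "\<And>j. j \<in> Basis \<Longrightarrow> l j \<le> u j"
  shows "emeasure lborel (brick l u) = ennreal (\<Prod>j\<in>Basis. u j - l j)"
  using assms by (simp add: brick_def emeasure_lborel_cbox_eq inner_sum_left_Basis inner_diff_left)

definition slab :: "'a::euclidean_space \<Rightarrow> real \<Rightarrow> real \<Rightarrow> real \<Rightarrow> 'a set" where
  "slab b R s t = brick ((\<lambda>_. - R)(b := s)) ((\<lambda>_. R)(b := t))"

lemma mem_slab:
  assumes "b \<in> Basis"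
  shows "x \<in> slab b R s t \<longleftrightarrow> s \<le> x \<bullet> b \<and> x \<bullet> b \<le> t \<and> (\<forall>j\<in>Basis - {b}. \<bar>x \<bullet> j\<bar> \<le> R)"
  using assms by (auto simp: slab_def mem_brick abs_le_iff minus_le_iff)

lemma compact_slab: "compact (slab b R s t)"
  and convex_slab: "convex (slab b R s t)"
  by (simp_all add: slab_def compact_brick convex_brick)

lemma sets_slab [measurable]: "slab b R s t \<in> sets borel"
  by (simp add: slab_def)

lemma emeasure_slab:
  fixes b :: "'a::euclidean_space"
  assumes "b \<in> Basis" "0 \<le> R" "s \<le> t"
  shows "emeasure lborel (slab b R s t) = ennreal ((t - s) * (2 * R) ^ (DIM('a) - 1))"
proof -
  have "(\<Prod>j\<in>Basis. ((\<lambda>_. R)(b := t)) j - ((\<lambda>_. - R)(b := s)) j)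
      = (t - s) * (\<Prod>j\<in>Basis - {b}. 2 * R)"
    using assms by (subst prod.remove[of _ b]) (auto intro!: prod.cong)
  then show ?thesis
    using assms unfolding slab_def by (subst emeasure_brick) (auto simp: card_Diff_singleton)
qed

text \<open>For a unit vector \<open>u\<close>, \<open>u \<bullet> x\<close> is bounded away from 0 with constant sign on an orthant
  box, and one of the two opposite boxes lies on the far side of the mean.\<close>
lemma eps_ge:
  fixes P :: "'a::euclidean_space measure"
  assumes P: "P \<in> projectable_distributions" and "0 \<le> r"
    and k: "\<And>s. (\<And>j. \<bar>s j\<bar> = 1) \<Longrightarrow> k \<le> measure P {x. \<forall>j\<in>Basis. r \<le> s j * (x \<bullet> j) \<and> s j * (x \<bullet> j) \<le> 2 * r}"
  shows "r * k \<le> eps P"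
  unfolding eps_def
proof (rule cINF_greatest)
  obtain b :: 'a where "b \<in> Basis" using nonempty_Basis by blast
  then show "{u::'a. norm u = 1} \<noteq> {}" using norm_Basis by blast
next
  fix u :: 'a assume "u \<in> {u. norm u = 1}"
  then have u: "norm u = 1" by simp
  interpret prob_space P using P by (simp add: projectable_distributions_def)
  have [simp, measurable_cong]: "sets P = sets borel" and int: "integrable P norm"
    using P by (auto simp: projectable_distributions_def)
  define m where "m = u \<bullet> mean P"
  \<comment> \<open>\<tau> selects the side on which subtracting \<open>m\<close> only increases
    \<open>\<tau> * (u \<bullet> x)\<close>. The signs \<open>s\<close> make every term of
    \<open>\<tau> * (u \<bullet> x)\<close> equal to
    \<open>\<bar>u \<bullet> j\<bar> * (s j * (x \<bullet> j))\<close>, which is nonnegative on the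
    box \<open>B\<close>.\<close>
  define \<tau> :: real where "\<tau> = (if m \<le> 0 then 1 else -1)"
  define s where "s = (\<lambda>j. \<tau> * (if 0 \<le> u \<bullet> j then 1 else -1))"
  define B where "B = {x. \<forall>j\<in>Basis. r \<le> s j * (x \<bullet> j) \<and> s j * (x \<bullet> j) \<le> 2 * r}"
  have [measurable]: "B \<in> sets borel" unfolding B_def by measurable
  have \<tau>: "\<bar>\<tau>\<bar> = 1" "\<tau> * m \<le> 0" by (auto simp: \<tau>_def)
  have kB: "k \<le> measure P B" unfolding B_def using \<tau>(1) by (intro k) (simp add: s_def abs_mult)
  have int_u: "integrable P (\<lambda>x. \<bar>u \<bullet> (x - mean P)\<bar>)"
  proof (rule Bochner_Integration.integrable_bound)
    show "integrable P (\<lambda>x. norm x + norm (mean P))" using int by simp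
    show "AE x in P. norm \<bar>u \<bullet> (x - mean P)\<bar> \<le> norm (norm x + norm (mean P))"
    proof (rule AE_I2)
      fix x
      have "\<bar>u \<bullet> (x - mean P)\<bar> \<le> norm u * norm (x - mean P)" by (rule Cauchy_Schwarz_ineq2)
      also have "\<dots> \<le> norm x + norm (mean P)" using u norm_triangle_ineq4 by simp
      finally show "norm \<bar>u \<bullet> (x - mean P)\<bar> \<le> norm (norm x + norm (mean P))" by simp
    qed
  qed measurable
  have "r * indicator B x \<le> \<bar>u \<bullet> (x - mean P)\<bar>" for x
  proof (cases "x \<in> B")
    case True
    \<comment> \<open>A unit vector has l1 norm at least 1.\<close>
    have "r \<le> r * (\<Sum>j\<in>Basis. \<bar>u \<bullet> j\<bar>)"
      using norm_le_l1[of u] u \<open>0 \<le> r\<close> by (simp add: mult_le_cancel_left1)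
    also have "\<dots> = (\<Sum>j\<in>Basis. \<bar>u \<bullet> j\<bar> * r)" by (simp add: sum_distrib_left mult.commute)
    also have "\<dots> \<le> (\<Sum>j\<in>Basis. \<bar>u \<bullet> j\<bar> * (s j * (x \<bullet> j)))"
      using True by (intro sum_mono mult_left_mono) (auto simp: B_def)
    also have "\<dots> = (\<Sum>j\<in>Basis. \<tau> * ((u \<bullet> j) * (x \<bullet> j)))"
      by (intro sum.cong) (auto simp: s_def)
    also have "\<dots> = \<tau> * (u \<bullet> x)" by (simp add: euclidean_inner[of u x] sum_distrib_left)
    also have "\<dots> \<le> \<tau> * (u \<bullet> x - m)" using \<tau>(2) by (simp add: right_diff_distrib)
    also have "\<dots> \<le> \<bar>\<tau>\<bar> * \<bar>u \<bullet> x - m\<bar>" by (metis abs_ge_self abs_mult)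
    finally show ?thesis using True by (simp add: m_def inner_diff_right \<tau>(1))
  qed simp
  then have "(\<integral>x. r * indicator B x \<partial>P) \<le> (\<integral>x. \<bar>u \<bullet> (x - mean P)\<bar> \<partial>P)"
    using int_u by (intro integral_mono) (auto simp: less_top[symmetric])
  moreover have "(\<integral>x. r * indicator B x \<partial>P) = r * measure P B"
    by (simp add: sets_eq_imp_space_eq[OF \<open>sets P = sets borel\<close>])
  moreover have "r * k \<le> r * measure P B" using kB \<open>0 \<le> r\<close> by (rule mult_left_mono)
  ultimately show "r * k \<le> (\<integral>x. \<bar>u \<bullet> (x - mean P)\<bar> \<partial>P)" by linarith
qed

text \<open>With \<open>r = R / 4\<close> all orthant boxes lie in the inner cube of half-width
  \<open>R / 2\<close>. They have side \<open>R / 4\<close> against \<open>2 * R\<close> for the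
  full cube, which gives mass 1/8 per dimension.\<close>

lemma eps_density_ge:
  fixes f :: "'a::euclidean_space \<Rightarrow> real"
  assumes P: "density lborel f \<in> projectable_distributions" and R: "0 < R"
    and [measurable]: "f \<in> borel_measurable borel"
    and f: "\<And>x. (\<And>j. j \<in> Basis \<Longrightarrow> \<bar>x \<bullet> j\<bar> \<le> R / 2) \<Longrightarrow> f x = 1 / (2 * R) ^ DIM('a)"
  shows "R / 4 * (1 / 8) ^ DIM('a) \<le> eps (density lborel f)"
proof (rule eps_ge[OF P])
  interpret prob_space "density lborel f" using P by (simp add: projectable_distributions_def)
  fix s :: "'a \<Rightarrow> real" assume s: "\<And>j. \<bar>s j\<bar> = 1"
  define B where "B = {x. \<forall>j\<in>Basis. R / 4 \<le> s j * (x \<bullet> j) \<and> s j * (x \<bullet> j) \<le> 2 * (R / 4)}"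
  have s': "s j = 1 \<or> s j = -1" for j using s[of j] by linarith
  have B: "B = brick (\<lambda>j. if s j = 1 then R / 4 else - (R / 2)) (\<lambda>j. if s j = 1 then R / 2 else - (R / 4))"
  proof (rule set_eqI)
    fix x
    have "R / 4 \<le> s j * (x \<bullet> j) \<and> s j * (x \<bullet> j) \<le> 2 * (R / 4) \<longleftrightarrow>
      (if s j = 1 then R / 4 else - (R / 2)) \<le> x \<bullet> j \<and> x \<bullet> j \<le> (if s j = 1 then R / 2 else - (R / 4))" for j
      using s'[of j] by auto
    then show "x \<in> B \<longleftrightarrow> x \<in> brick (\<lambda>j. if s j = 1 then R / 4 else - (R / 2)) (\<lambda>j. if s j = 1 then R / 2 else - (R / 4))"
      by (simp add: B_def mem_brick)
  qed
  have [measurable]: "B \<in> sets borel" unfolding B by measurable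
  have "emeasure lborel B = ennreal (\<Prod>j\<in>(Basis :: 'a set). R / 4)"
    unfolding B using R
    by (subst emeasure_brick) (auto intro!: arg_cong[where f = ennreal] prod.cong simp del: prod_constant)
  also have "\<dots> = ennreal ((R / 4) ^ DIM('a))" by simp
  finally have eB: "emeasure lborel B = ennreal ((R / 4) ^ DIM('a))" .
  have fB: "f x = 1 / (2 * R) ^ DIM('a)" if "x \<in> B" for x
  proof (rule f)
    fix j :: 'a assume "j \<in> Basis"
    then show "\<bar>x \<bullet> j\<bar> \<le> R / 2" using that s'[of j] R by (auto simp: B_def)
  qed
  have "emeasure (density lborel f) B = (\<integral>\<^sup>+x. ennreal (1 / (2 * R) ^ DIM('a)) * indicator B x \<partial>lborel)"
    by (auto simp: emeasure_density indicator_def fB intro!: nn_integral_cong)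
  also have "\<dots> = ennreal (1 / (2 * R) ^ DIM('a)) * ennreal ((R / 4) ^ DIM('a))"
    by (simp add: nn_integral_cmult_indicator eB)
  also have "\<dots> = ennreal (1 / (2 * R) ^ DIM('a) * (R / 4) ^ DIM('a))"
    using R by (intro ennreal_mult[symmetric]) auto
  also have "1 / (2 * R) ^ DIM('a) * (R / 4) ^ DIM('a) = (1 / (2 * R) * (R / 4)) ^ DIM('a)"
    by (simp only: power_mult_distrib power_divide power_one)
  also have "1 / (2 * R) * (R / 4) = 1 / 8" using R by simp
  finally have "measure (density lborel f) B = (1 / 8) ^ DIM('a)"
    by (simp add: measure_def)
  then show "(1 / 8) ^ DIM('a) \<le> measure (density lborel f)
      {x. \<forall>j\<in>Basis. R / 4 \<le> s j * (x \<bullet> j) \<and> s j * (x \<bullet> j) \<le> 2 * (R / 4)}"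
    unfolding B_def[symmetric] by simp
qed (use R in simp)

subsection \<open>The uniform cube and its trapezoidal modification\<close>

text \<open>The bound \<open>h \<le> R / 2\<close> starts the descent at \<open>R / 2\<close> or
  later, so that both densities are constant on the inner cube of
  \<open>eps_density_ge\<close>.\<close>

locale trapezoid =
  fixes b :: "'a::euclidean_space" and R h :: real
  assumes b: "b \<in> Basis" and R: "0 < R" and h: "0 < h" "h \<le> R / 2"
begin

definition v :: real where "v = 1 / (2 * R) ^ DIM('a)"

text \<open>A minimum of affine functions, hence continuous and concave on the whole space. It
  becomes negative beyond \<open>R + h\<close>, where the truncation in \<open>q\<close> removes
  it.\<close>

definition \<phi> :: "'a \<Rightarrow> real" where "\<phi> x = v * min 1 ((R + h - x \<bullet> b) / (2 * h))"

definition p :: "'a \<Rightarrow> real" where "p x = (if x \<in> slab b R (- R) R then v else 0)"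

definition q :: "'a \<Rightarrow> real" where "q x = (if x \<in> slab b R (- R) (R + h) then \<phi> x else 0)"

definition \<sigma> :: "'a \<Rightarrow> 'a" where "\<sigma> x = x + (2 * (R - x \<bullet> b)) *\<^sub>R b"

lemma v_pos: "0 < v" using R by (simp add: v_def)

text \<open>Slabs have cross-section volume \<open>(2 * R) ^ (DIM('a) - 1)\<close>; this identity
  removes the dimension from all integrals over them.\<close>

lemma v_eq: "v * (2 * R) ^ (DIM('a) - 1) = 1 / (2 * R)"
proof -
  have "(2 * R) ^ DIM('a) = (2 * R) * (2 * R) ^ (DIM('a) - 1)"
    using DIM_positive[where 'a = 'a] by (metis power_eq_if not_gr_zero)
  then show ?thesis using R by (simp add: v_def)
qed

lemma \<phi>_le: "\<phi> x \<le> v" using v_pos by (simp add: \<phi>_def mult_left_le)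

lemma \<phi>_nonneg: "x \<bullet> b \<le> R + h \<Longrightarrow> 0 \<le> \<phi> x" using v_pos h by (simp add: \<phi>_def)

lemma \<phi>_eq_v: "x \<bullet> b \<le> R - h \<Longrightarrow> \<phi> x = v" using h by (simp add: \<phi>_def min_def field_simps)

lemma continuous_on_\<phi>: "continuous_on UNIV \<phi>"
  unfolding \<phi>_def using h by (intro continuous_intros) auto

lemma concave_on_\<phi>: "convex S \<Longrightarrow> concave_on S \<phi>"
  unfolding concave_on_iff
proof (intro conjI ballI allI impI)
  fix x y s t
  assume st: "(0::real) \<le> s" "(0::real) \<le> t" "s + t = 1"
  let ?l = "\<lambda>x. (R + h - x \<bullet> b) / (2 * h)"
  have "s * min 1 (?l x) + t * min 1 (?l y) \<le> s * 1 + t * 1"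
    using st by (intro add_mono mult_left_mono) auto
  moreover have "s * min 1 (?l x) + t * min 1 (?l y) \<le> s * ?l x + t * ?l y"
    using st by (intro add_mono mult_left_mono) auto
  moreover have "s * ?l x + t * ?l y = ?l (s *\<^sub>R x + t *\<^sub>R y)"
  proof -
    have "s * ?l x + t * ?l y = ((s + t) * (R + h) - (s * (x \<bullet> b) + t * (y \<bullet> b))) / (2 * h)"
      using h by (simp add: field_simps)
    then show ?thesis using st by (simp add: inner_add_left)
  qed
  ultimately have "s * min 1 (?l x) + t * min 1 (?l y) \<le> min 1 (?l (s *\<^sub>R x + t *\<^sub>R y))"
    using st by simp
  from mult_left_mono[OF this, of v] v_pos
  show "s * \<phi> x + t * \<phi> y \<le> \<phi> (s *\<^sub>R x + t *\<^sub>R y)"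
    by (simp add: \<phi>_def algebra_simps)
qed

lemma measurable_\<phi> [measurable]: "\<phi> \<in> borel_measurable borel"
  using continuous_on_\<phi> by (rule borel_measurable_continuous_onI)

lemma measurable_pq [measurable]: "p \<in> borel_measurable borel" "q \<in> borel_measurable borel"
  unfolding p_def q_def by measurable

lemma measurable_\<sigma> [measurable]: "\<sigma> \<in> borel_measurable borel"
  unfolding \<sigma>_def by measurable

lemma p_nonneg: "0 \<le> p x" using v_pos by (simp add: p_def)

lemma q_nonneg: "0 \<le> q x" using \<phi>_nonneg by (auto simp: q_def mem_slab[OF b])

lemma inner_\<sigma>: "j \<in> Basis \<Longrightarrow> \<sigma> x \<bullet> j = (if j = b then 2 * R - x \<bullet> b else x \<bullet> j)"
  using b by (auto simp: \<sigma>_def inner_add_left inner_Basis)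

lemma \<sigma>_\<sigma>: "\<sigma> (\<sigma> x) = x"
  by (rule euclidean_eqI) (simp add: inner_\<sigma> b)

lemma distr_\<sigma>: "distr lborel borel \<sigma> = lborel"
  unfolding \<sigma>_def by (rule distr_lborel_reflection[OF b])

lemma norm_diff_\<sigma>: "norm (x - \<sigma> x) = 2 * \<bar>R - x \<bullet> b\<bar>"
  using b by (simp add: \<sigma>_def abs_if)

lemma nn_integral_p: "(\<integral>\<^sup>+x. ennreal (p x) \<partial>lborel) = 1"
proof -
  have "(\<integral>\<^sup>+x. ennreal (p x) \<partial>lborel) = (\<integral>\<^sup>+x. ennreal v * indicator (slab b R (- R) R) x \<partial>lborel)"
    by (auto simp: p_def indicator_def intro!: nn_integral_cong)
  also have "\<dots> = ennreal v * ennreal ((2 * R) * (2 * R) ^ (DIM('a) - 1))"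
    using b R by (simp add: nn_integral_cmult_indicator emeasure_slab)
  also have "\<dots> = ennreal ((2 * R) * (v * (2 * R) ^ (DIM('a) - 1)))"
    using R v_pos by (simp add: ennreal_mult'[symmetric] mult_ac)
  finally show ?thesis unfolding v_eq using R by simp
qed

text \<open>\<open>w1\<close> is the mass that \<open>p\<close> and \<open>q\<close> share inside
  the cube, and \<open>w2\<close> is the excess of \<open>p\<close> over \<open>q\<close> there, to
  be reflected outwards by \<sigma>.\<close>

definition w1 :: "'a \<Rightarrow> real" where "w1 x = (if x \<in> slab b R (- R) R then \<phi> x else 0)"

definition w2 :: "'a \<Rightarrow> real" where "w2 x = (if x \<in> slab b R (- R) R then v - \<phi> x else 0)"

lemma measurable_w [measurable]: "w1 \<in> borel_measurable borel" "w2 \<in> borel_measurable borel"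
  unfolding w1_def w2_def by measurable

lemma w_nonneg: "0 \<le> w1 x" "0 \<le> w2 x"
  using \<phi>_nonneg \<phi>_le h by (auto simp: w1_def w2_def mem_slab[OF b])

lemma p_eq: "p x = w1 x + w2 x" by (simp add: p_def w1_def w2_def)

text \<open>The profile of \<open>q\<close> is antisymmetric about its value at \<open>x \<bullet> b = R\<close>; on that hyperplane
  itself \<open>w1\<close> and the reflected \<open>w2\<close> overlap.\<close>
lemma q_eq:
  assumes "x \<bullet> b \<noteq> R"
  shows "q x = w1 x + w2 (\<sigma> x)"
proof -
  have ball: "(\<forall>j\<in>Basis - {b}. \<bar>\<sigma> x \<bullet> j\<bar> \<le> R) \<longleftrightarrow> (\<forall>j\<in>Basis - {b}. \<bar>x \<bullet> j\<bar> \<le> R)"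
    by (auto simp: inner_\<sigma>)
  have \<sigma>b: "\<sigma> x \<bullet> b = 2 * R - x \<bullet> b" using b by (simp add: inner_\<sigma>)
  consider "x \<bullet> b < R" | "R < x \<bullet> b" "x \<bullet> b \<le> R + h" | "R + h < x \<bullet> b" using assms by linarith
  then show ?thesis
  proof cases
    case 1
    then show ?thesis using h by (auto simp: q_def w1_def w2_def mem_slab[OF b] ball \<sigma>b)
  next
    case 2
    have "\<phi> x = v * ((R + h - x \<bullet> b) / (2 * h))"
      using 2 h by (simp add: \<phi>_def min_absorb2 divide_le_eq)
    moreover have "\<phi> (\<sigma> x) = v * ((h - R + x \<bullet> b) / (2 * h))"
      using 2 h by (simp add: \<phi>_def \<sigma>b min_absorb2 divide_le_eq)
    moreover have "(h - R + x \<bullet> b) / (2 * h) = 1 - (R + h - x \<bullet> b) / (2 * h)"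
      using h by (simp add: field_simps)
    ultimately have "\<phi> x = v - \<phi> (\<sigma> x)" by (simp add: right_diff_distrib)
    then show ?thesis using 2 h
      by (auto simp: q_def w1_def w2_def mem_slab[OF b] ball \<sigma>b)
  next
    case 3
    \<comment> \<open>Beyond the descent the reflected point falls where the profile is flat, so it
      carries no excess.\<close>
    then have "\<phi> (\<sigma> x) = v" by (intro \<phi>_eq_v) (simp add: \<sigma>b)
    then show ?thesis using 3 h by (auto simp: q_def w1_def w2_def mem_slab[OF b] ball \<sigma>b)
  qed
qed

lemma AE_q_eq: "AE x in lborel. ennreal (q x) = ennreal (w1 x) + ennreal (w2 (\<sigma> x))"
proof -
  have "{x. b \<bullet> x = R} \<in> null_sets lborel"
    using b nonzero_Basis by (intro hyperplane_null_sets_lborel) auto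
  then have "AE x in lborel. x \<notin> {x. b \<bullet> x = R}" by (rule AE_not_in)
  then show ?thesis
    by eventually_elim (simp add: q_eq inner_commute w_nonneg)
qed

text \<open>Reflection preserves mass, so \<open>q\<close> inherits its total from \<open>p\<close>
  and the linear profile never has to be integrated.\<close>

lemma nn_integral_q: "(\<integral>\<^sup>+x. ennreal (q x) \<partial>lborel) = 1"
proof -
  have "(\<integral>\<^sup>+x. ennreal (q x) \<partial>lborel) = (\<integral>\<^sup>+x. ennreal (w1 x) + ennreal (w2 (\<sigma> x)) \<partial>lborel)"
    using AE_q_eq by (rule nn_integral_cong_AE)
  also have "\<dots> = (\<integral>\<^sup>+x. ennreal (w1 x) \<partial>lborel) + (\<integral>\<^sup>+x. ennreal (w2 (\<sigma> x)) \<partial>lborel)"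
    by (rule nn_integral_add) auto
  also have "(\<integral>\<^sup>+x. ennreal (w2 (\<sigma> x)) \<partial>lborel) = (\<integral>\<^sup>+x. ennreal (w2 x) \<partial>lborel)"
    by (subst (2) distr_\<sigma>[symmetric]) (simp add: nn_integral_distr)
  also have "(\<integral>\<^sup>+x. ennreal (w1 x) \<partial>lborel) + \<dots> = (\<integral>\<^sup>+x. ennreal (p x) \<partial>lborel)"
    by (subst nn_integral_add[symmetric]) (auto simp: p_eq w_nonneg)
  finally show ?thesis by (simp add: nn_integral_p)
qed

lemma projectable_p: "density lborel p \<in> projectable_distributions"
  by (rule projectable_density_compact[of _ "slab b R (- R) R"])
    (auto simp: p_nonneg nn_integral_p intro: compact_imp_bounded compact_slab, simp add: p_def)

lemma projectable_q: "density lborel q \<in> projectable_distributions"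
  by (rule projectable_density_compact[of _ "slab b R (- R) (R + h)"])
    (auto simp: q_nonneg nn_integral_q intro: compact_imp_bounded compact_slab, simp add: q_def)

lemma eps_p: "R / 4 * (1 / 8) ^ DIM('a) \<le> eps (density lborel p)"
proof (rule eps_density_ge[OF projectable_p R])
  fix x :: 'a assume x: "\<And>j. j \<in> Basis \<Longrightarrow> \<bar>x \<bullet> j\<bar> \<le> R / 2"
  then have "x \<in> slab b R (- R) R"
    using R x[OF b] by (fastforce simp: mem_slab[OF b])
  then show "p x = 1 / (2 * R) ^ DIM('a)" by (simp add: p_def v_def)
qed measurable

lemma eps_q: "R / 4 * (1 / 8) ^ DIM('a) \<le> eps (density lborel q)"
proof (rule eps_density_ge[OF projectable_q R])
  fix x :: 'a assume x: "\<And>j. j \<in> Basis \<Longrightarrow> \<bar>x \<bullet> j\<bar> \<le> R / 2"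
  then have "x \<in> slab b R (- R) (R + h)"
    using R h x[OF b] by (fastforce simp: mem_slab[OF b])
  moreover have "\<phi> x = v" using x[OF b] h by (intro \<phi>_eq_v) linarith
  ultimately show "q x = 1 / (2 * R) ^ DIM('a)" by (simp add: q_def v_def)
qed measurable

text \<open>The excess has density at most \<open>v\<close>, lives on a strip of width
  \<open>h\<close> inside the face, and moves by at most \<open>2 * h\<close>.\<close>

lemma wasserstein_le: "wasserstein (density lborel p) (density lborel q) \<le> ennreal (h\<^sup>2 / R)"
proof -
  have "density lborel q = density lborel (\<lambda>x. ennreal (w1 x) + ennreal (w2 (\<sigma> x)))"
    using AE_q_eq by (intro density_cong) auto
  moreover have p: "ennreal (p x) = ennreal (w1 x) + ennreal (w2 x)" for x
    by (simp add: p_eq w_nonneg)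
  ultimately have "wasserstein (density lborel p) (density lborel q)
      \<le> (\<integral>\<^sup>+x. ennreal (w2 x) * ennreal (norm (x - \<sigma> x)) \<partial>lborel)"
    using wasserstein_le_involution[of "\<lambda>x. ennreal (w1 x)" "\<lambda>x. ennreal (w2 x)" \<sigma>]
      nn_integral_p distr_\<sigma> \<sigma>_\<sigma> by simp
  also have "\<dots> \<le> (\<integral>\<^sup>+x. ennreal (v * (2 * h)) * indicator (slab b R (R - h) R) x \<partial>lborel)"
  proof (rule nn_integral_mono)
    fix x
    show "ennreal (w2 x) * ennreal (norm (x - \<sigma> x))
      \<le> ennreal (v * (2 * h)) * indicator (slab b R (R - h) R) x"
    proof (cases "x \<in> slab b R (R - h) R")
      case True
      have "w2 x \<le> v" using \<phi>_nonneg[of x] v_pos h by (auto simp: w2_def mem_slab[OF b])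
      moreover have "norm (x - \<sigma> x) \<le> 2 * h"
        using True by (auto simp: norm_diff_\<sigma> mem_slab[OF b])
      ultimately have "w2 x * norm (x - \<sigma> x) \<le> v * (2 * h)"
        using v_pos by (intro mult_mono) auto
      then show ?thesis using True by (simp add: ennreal_mult''[symmetric] ennreal_leI)
    next
      case False
      then have "w2 x = 0" using \<phi>_eq_v[of x] by (auto simp: w2_def mem_slab[OF b])
      then show ?thesis by simp
    qed
  qed
  also have "\<dots> = ennreal (v * (2 * h)) * ennreal (h * (2 * R) ^ (DIM('a) - 1))"
    using b R h by (simp add: nn_integral_cmult_indicator emeasure_slab)
  also have "\<dots> = ennreal (2 * h * h * (v * (2 * R) ^ (DIM('a) - 1)))"
    using h v_pos by (simp add: ennreal_mult'[symmetric] mult_ac)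
  also have "2 * h * h * (v * (2 * R) ^ (DIM('a) - 1)) = h\<^sup>2 / R"
    unfolding v_eq using R by (simp add: power2_eq_square)
  finally show ?thesis .
qed

lemma hellinger_pq: "sqrt (h / (32 * R)) \<le> hellinger p q"
proof -
  have [simp]: "integrable lborel p" "integrable lborel q"
    using nn_integral_p nn_integral_q p_nonneg q_nonneg by (auto intro!: integrableI_nonneg)
  \<comment> \<open>On this strip outside the cube \<open>p\<close> vanishes, and \<open>q\<close>
    is at least its value \<open>v / 4\<close> at \<open>x \<bullet> b = R + h / 2\<close>. The
    strip starts strictly beyond \<open>R\<close>, as \<open>p\<close> still equals \<open>v\<close>
    on the face.\<close>
  let ?B = "slab b R (R + h / 4) (R + h / 2)"
  have eB: "emeasure lborel ?B = ennreal (h / 4 * (2 * R) ^ (DIM('a) - 1))"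
    using b R h by (simp add: emeasure_slab)
  have "(\<integral>x. v / 4 * indicator ?B x \<partial>lborel) \<le> (\<integral>x. (sqrt (p x) - sqrt (q x))\<^sup>2 \<partial>lborel)"
  proof (rule integral_mono)
    show "integrable lborel (\<lambda>x. v / 4 * indicator ?B x)"
      using eB by (intro integrable_mult_right integrable_real_indicator) auto
    show "integrable lborel (\<lambda>x. (sqrt (p x) - sqrt (q x))\<^sup>2)"
      by (intro integrable_hellinger p_nonneg q_nonneg) simp_all
    fix x
    show "v / 4 * indicator ?B x \<le> (sqrt (p x) - sqrt (q x))\<^sup>2"
    proof (cases "x \<in> ?B")
      case True
      then have x: "R + h / 4 \<le> x \<bullet> b" "x \<bullet> b \<le> R + h / 2" by (auto simp: mem_slab[OF b])
      then have "p x = 0" using h by (auto simp: p_def mem_slab[OF b])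
      moreover have "q x = \<phi> x" using True R h by (auto simp: q_def mem_slab[OF b])
      moreover have "1 / 4 \<le> min 1 ((R + h - x \<bullet> b) / (2 * h))"
        using x h by (simp add: le_divide_eq)
      then have "v * (1 / 4) \<le> \<phi> x"
        unfolding \<phi>_def using v_pos by (intro mult_left_mono) auto
      ultimately show ?thesis using True q_nonneg[of x] by simp
    qed simp
  qed
  moreover have "(\<integral>x. v / 4 * indicator ?B x \<partial>lborel) = v / 4 * (h / 4 * (2 * R) ^ (DIM('a) - 1))"
    using R h by (simp add: measure_def eB)
  moreover have "v / 4 * (h / 4 * (2 * R) ^ (DIM('a) - 1)) = h / 16 * (v * (2 * R) ^ (DIM('a) - 1))"
    by simp
  moreover have "h / 16 * (v * (2 * R) ^ (DIM('a) - 1)) = h / (32 * R)"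
    unfolding v_eq by simp
  ultimately show ?thesis
    unfolding hellinger_def by (intro real_sqrt_le_mono) linarith
qed

lemma hellinger_projection:
  "hellinger (log_concave_projection (density lborel p)) (log_concave_projection (density lborel q))
    = hellinger p q"
proof (rule hellinger_cong_AE)
  have p: "p = (\<lambda>x. if x \<in> slab b R (- R) R then v else 0)" by (simp add: p_def fun_eq_iff)
  have q: "q = (\<lambda>x. if x \<in> slab b R (- R) (R + h) then \<phi> x else 0)" by (simp add: q_def fun_eq_iff)
  have p1: "p \<in> log_concave_densities"
    unfolding p using nn_integral_p v_pos
    by (intro log_concave_densities_truncate compact_imp_closed compact_slab)
      (auto simp: concave_on_const convex_slab p)
  have q1: "q \<in> log_concave_densities"
    unfolding q using nn_integral_q \<phi>_nonneg
    by (intro log_concave_densities_truncate compact_imp_closed compact_slab continuous_on_\<phi>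
        concave_on_\<phi> convex_slab) (auto simp: q mem_slab[OF b])
  have p2: "integrable lborel (\<lambda>x. p x * ln (p x))"
    unfolding p using v_pos by (intro integrable_entropy_truncate compact_slab) auto
  have q2: "integrable lborel (\<lambda>x. q x * ln (q x))"
    unfolding q using \<phi>_nonneg
    by (intro integrable_entropy_truncate compact_slab continuous_on_\<phi>) (auto simp: mem_slab[OF b])
  show "AE x in lborel. log_concave_projection (density lborel p) x = p x"
    "log_concave_projection (density lborel p) \<in> borel_measurable borel"
    using log_concave_projection_AE_eq[OF p1 p2] by auto
  show "AE x in lborel. log_concave_projection (density lborel q) x = q x"
    "log_concave_projection (density lborel q) \<in> borel_measurable borel"
    using log_concave_projection_AE_eq[OF q1 q2] by auto
qed measurable

end

section \<open>Choice of the parameters\<close>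

theorem theorem4:
  shows "\<exists>c>0. \<forall>\<epsilon>>0. \<forall>\<delta>>0.
    \<exists>P\<in>(projectable_distributions :: (real ^ 'n) measure set). \<exists>Q\<in>projectable_distributions.
      eps P \<ge> \<epsilon> \<and> eps Q \<ge> \<epsilon> \<and> wasserstein P Q \<le> ennreal \<delta> \<and>
      hellinger (log_concave_projection P) (log_concave_projection Q)
        \<ge> c * min 1 ((\<delta> / \<epsilon>) powr (1 / 4))"
proof -
  obtain b :: "real ^ 'n" where b: "b \<in> Basis" using nonempty_Basis by blast
  \<comment> \<open>Chosen so that \<open>R = C * \<epsilon>\<close> turns the lower bound of
    \<open>eps_p\<close> and \<open>eps_q\<close> into exactly \<epsilon>.\<close>
  define C :: real where "C = 4 * 8 ^ DIM(real ^ 'n)"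
  have C: "4 \<le> C" by (simp add: C_def)
  \<comment> \<open>The factor 1/6 comes from \<open>1 / 36 \<le> 1 / 32\<close>, the latter being
    the constant of \<open>hellinger_pq\<close>; the power of \<open>1 / C\<close> comes from
    \<open>R = C * \<epsilon>\<close>.\<close>
  define c where "c = 1 / 6 * (1 / C) powr (1 / 4)"
  have "0 < c" using C by (simp add: c_def)
  moreover have "\<exists>P\<in>(projectable_distributions :: (real ^ 'n) measure set).
      \<exists>Q\<in>projectable_distributions. eps P \<ge> \<epsilon> \<and> eps Q \<ge> \<epsilon> \<and> wasserstein P Q \<le> ennreal \<delta> \<and>
      hellinger (log_concave_projection P) (log_concave_projection Q)
        \<ge> c * min 1 ((\<delta> / \<epsilon>) powr (1 / 4))" if pos: "\<epsilon> > 0" "\<delta> > 0" for \<epsilon> \<delta> :: real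
  proof -
    define R where "R = C * \<epsilon>"
    \<comment> \<open>The second entry is the largest \<open>h\<close> with transport bound
      \<open>h\<^sup>2 / R\<close> at most \<delta>; the first is the locale's restriction.\<close>
    define h where "h = min (R / 2) (sqrt (\<delta> * R))"
    have R: "0 < R" using C pos by (simp add: R_def)
    interpret trapezoid b R h
      by unfold_locales (use b R pos in \<open>auto simp: h_def\<close>)
    have eps: "R / 4 * (1 / 8) ^ DIM(real ^ 'n) = \<epsilon>"
      by (simp add: R_def C_def power_one_over)
    have "h\<^sup>2 \<le> (sqrt (\<delta> * R))\<^sup>2" using h by (intro power_mono) (auto simp: h_def)
    then have W: "h\<^sup>2 / R \<le> \<delta>" using R pos by (simp add: field_simps)
    \<comment> \<open>Taking the minimum before the fourth root treats both entries of
      \<open>h\<close> at once: \<open>m \<le> 1\<close> and \<open>4 \<le> C\<close> handle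
      \<open>R / 2\<close>, while \<open>m \<le> \<delta> / \<epsilon>\<close> handles the square
      root.\<close>
    define m where "m = min 1 (\<delta> / \<epsilon>)"
    have m: "0 < m" "m \<le> 1" "m \<le> \<delta> / \<epsilon>" using pos by (auto simp: m_def)
    have "sqrt (m / C) \<le> h / R"
    proof -
      have "m / C \<le> (1 / 2)\<^sup>2" using m C by (simp add: field_simps power2_eq_square)
      then have "sqrt (m / C) \<le> 1 / 2" by (intro real_le_lsqrt) auto
      moreover have "m / C \<le> (\<delta> / \<epsilon>) / C" using m C by (intro divide_right_mono) auto
      then have "sqrt (m / C) \<le> sqrt (\<delta> / R)" by (simp add: R_def mult.commute)
      moreover have "sqrt (\<delta> * R) / R = sqrt (\<delta> / R)"
        using R by (metis less_imp_le real_div_sqrt real_sqrt_divide real_sqrt_mult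
            divide_divide_eq_right times_divide_eq_right)
      ultimately show ?thesis using R by (auto simp: h_def min_def)
    qed
    then have "sqrt (sqrt (m / C)) \<le> sqrt (h / R)" by (rule real_sqrt_le_mono)
    moreover have "sqrt (sqrt (m / C)) = (m / C) powr (1 / 4)"
      using m C by (simp add: powr_powr flip: powr_half_sqrt)
    moreover have "(m / C) powr (1 / 4) = m powr (1 / 4) * (1 / C) powr (1 / 4)"
      using m C powr_mult[of m "1 / C" "1 / 4"] by simp
    moreover have "m powr (1 / 4) = min 1 ((\<delta> / \<epsilon>) powr (1 / 4))"
    proof (cases "\<delta> / \<epsilon> \<le> 1")
      case True
      then show ?thesis using pos powr_le1[of "1 / 4" "\<delta> / \<epsilon>"] by (simp add: m_def min_def)
    next
      case False
      then show ?thesis using pos ge_one_powr_ge_zero[of "\<delta> / \<epsilon>" "1 / 4"] by (simp add: m_def min_def)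
    qed
    ultimately have "min 1 ((\<delta> / \<epsilon>) powr (1 / 4)) * (1 / C) powr (1 / 4) \<le> sqrt (h / R)"
      by metis
    from mult_left_mono[OF this, of "1 / 6"]
    have "c * min 1 ((\<delta> / \<epsilon>) powr (1 / 4)) \<le> 1 / 6 * sqrt (h / R)"
      unfolding c_def by (simp add: ac_simps)
    also have "\<dots> \<le> sqrt (h / (32 * R))"
    proof -
      have "sqrt (1 / 36) = sqrt ((1 / 6)\<^sup>2)" by (simp add: power2_eq_square)
      then have "1 / 6 * sqrt (h / R) = sqrt ((1 / 36) * (h / R))"
        unfolding real_sqrt_mult by simp
      also have "\<dots> \<le> sqrt (h / (32 * R))" using h R by (intro real_sqrt_le_mono) (simp add: field_simps)
      finally show ?thesis .
    qed
    also have "\<dots> \<le> hellinger (log_concave_projection (density lborel p))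
        (log_concave_projection (density lborel q))"
      unfolding hellinger_projection by (rule hellinger_pq)
    finally show ?thesis
      using projectable_p projectable_q eps_p[unfolded eps] eps_q[unfolded eps]
        order_trans[OF wasserstein_le ennreal_leI[OF W]] by blast
  qed
  ultimately show ?thesis by blast
qed

end
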